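(* There is an algorithm that, given an $n$-vertex $d$-degenerated undirected graph $G$, runs in time $O(dn\log n)$ and outputs a dominating set of $G$ whose size is at most $d^2$ times the size of a minimum dominating set of $G$.
   Context: A dominating set of $G=(V,E)$ is a set $S\subseteq V$ such that every vertex is in $S$ or adjacent to a vertex of $S$. $G$ is $d$-degenerated if every subgraph of $G$ has a vertex of degree at most $d$.
   Formalization: The formal statement assumes d ≥ 1: for d = 0 the claim fails on every nonempty edgeless graph, whose minimum dominating set is nonempty while d² times its size is 0. The time bound is stated for n ≥ 2, where log n is positive. *)

theory Defs
  imports Complex_Main
begin

section \<open>Graphs, dominating sets, degeneracy\<close>

definition simple_graph :: "'a set \<Rightarrow> 'a set set \<Rightarrow> bool" where
  "simple_graph V E \<longleftrightarrow> finite V \<and> (\<forall>e\<in>E. e \<subseteq> V \<and> card e = 2)"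

definition subgraph :: "'a set \<Rightarrow> 'a set set \<Rightarrow> 'a set \<Rightarrow> 'a set set \<Rightarrow> bool" where
  "subgraph V' E' V E \<longleftrightarrow> simple_graph V' E' \<and> V' \<subseteq> V \<and> E' \<subseteq> E"

definition degree :: "'a set set \<Rightarrow> 'a \<Rightarrow> nat" where
  "degree E v = card {e \<in> E. v \<in> e}"

definition degenerate :: "nat \<Rightarrow> 'a set \<Rightarrow> 'a set set \<Rightarrow> bool" where
  "degenerate d V E \<longleftrightarrow>
     (\<forall>V' E'. subgraph V' E' V E \<and> V' \<noteq> {} \<longrightarrow> (\<exists>v\<in>V'. degree E' v \<le> d))"

definition dominating_set :: "'a set \<Rightarrow> 'a set set \<Rightarrow> 'a set \<Rightarrow> bool" where
  "dominating_set V E S \<longleftrightarrow> S \<subseteq> V \<and> (\<forall>v\<in>V. v \<in> S \<or> (\<exists>u\<in>S. {u, v} \<in> E))"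

definition domination_number :: "'a set \<Rightarrow> 'a set set \<Rightarrow> nat" where
  "domination_number V E = Min (card ` {S. dominating_set V E S})"


section \<open>A random access machine language with unit-cost operations\<close>

text \<open>
  Algorithms are programs of a while language over natural-number scalar variables and
  arrays. The names of scalars and arrays are fixed in the program text; array indices are
  computed, which gives indirect addressing. The arithmetic is that of the usual uniform-cost
  random access machine: addition and truncated subtraction, but no multiplication or shifts.
\<close>

datatype exp =
    Num nat
  | Var nat
  | Read nat exp
  | Plus exp exp
  | Minus exp exp

datatype bexp =
    Less exp exp
  | Equal exp exp
  | Neg bexp
  | Conj bexp bexp

datatype com =
    Skip
  | Assign nat exp
  | Write nat exp exp
  | Seq com com
  | Cond bexp com com
  | While bexp com

record state =
  scalars :: "nat \<Rightarrow> nat"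
  arrays :: "nat \<Rightarrow> nat \<Rightarrow> nat"

primrec eval :: "state \<Rightarrow> exp \<Rightarrow> nat" where
  "eval s (Num k) = k"
| "eval s (Var x) = scalars s x"
| "eval s (Read a e) = arrays s a (eval s e)"
| "eval s (Plus e f) = eval s e + eval s f"
| "eval s (Minus e f) = eval s e - eval s f"

primrec beval :: "state \<Rightarrow> bexp \<Rightarrow> bool" where
  "beval s (Less e f) \<longleftrightarrow> eval s e < eval s f"
| "beval s (Equal e f) \<longleftrightarrow> eval s e = eval s f"
| "beval s (Neg b) \<longleftrightarrow> \<not> beval s b"
| "beval s (Conj b c) \<longleftrightarrow> beval s b \<and> beval s c"

primrec ecost :: "exp \<Rightarrow> nat" where
  "ecost (Num k) = 1"
| "ecost (Var x) = 1"
| "ecost (Read a e) = 1 + ecost e"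
| "ecost (Plus e f) = 1 + ecost e + ecost f"
| "ecost (Minus e f) = 1 + ecost e + ecost f"

primrec bcost :: "bexp \<Rightarrow> nat" where
  "bcost (Less e f) = 1 + ecost e + ecost f"
| "bcost (Equal e f) = 1 + ecost e + ecost f"
| "bcost (Neg b) = 1 + bcost b"
| "bcost (Conj b c) = 1 + bcost b + bcost c"

text \<open>\<open>exec c s t s'\<close>: started in \<open>s\<close>, the program \<open>c\<close> halts in \<open>s'\<close> after \<open>t\<close> elementary steps.\<close>

inductive exec :: "com \<Rightarrow> state \<Rightarrow> nat \<Rightarrow> state \<Rightarrow> bool" where
  Skip: "exec Skip s 1 s"
| Assign: "exec (Assign x e) s (1 + ecost e) (s\<lparr>scalars := (scalars s)(x := eval s e)\<rparr>)"
| Write: "exec (Write a i e) s (1 + ecost i + ecost e)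
    (s\<lparr>arrays := (arrays s)(a := (arrays s a)(eval s i := eval s e))\<rparr>)"
| Seq: "exec c1 s t1 s' \<Longrightarrow> exec c2 s' t2 s'' \<Longrightarrow> exec (Seq c1 c2) s (t1 + t2) s''"
| CondTrue: "beval s b \<Longrightarrow> exec c1 s t s' \<Longrightarrow> exec (Cond b c1 c2) s (1 + bcost b + t) s'"
| CondFalse: "\<not> beval s b \<Longrightarrow> exec c2 s t s' \<Longrightarrow> exec (Cond b c1 c2) s (1 + bcost b + t) s'"
| WhileFalse: "\<not> beval s b \<Longrightarrow> exec (While b c) s (1 + bcost b) s"
| WhileTrue: "beval s b \<Longrightarrow> exec c s t1 s' \<Longrightarrow> exec (While b c) s' t2 s'' \<Longrightarrow>
    exec (While b c) s (1 + bcost b + t1 + t2) s''"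

inductive_cases SkipE: "exec Skip s t s'"
inductive_cases AssignE: "exec (Assign x e) s t s'"
inductive_cases WriteE: "exec (Write a i e) s t s'"
inductive_cases SeqE: "exec (Seq c1 c2) s t s'"
inductive_cases CondE: "exec (Cond b c1 c2) s t s'"
inductive_cases WhileE: "exec (While b c) s t s'"

lemma exec_deterministic:
  "exec c s t s' \<Longrightarrow> exec c s u s'' \<Longrightarrow> u = t \<and> s'' = s'"
proof (induction arbitrary: u s'' rule: exec.induct)
  case (Skip s)
  from Skip.prems show ?case by (rule SkipE) simp
next
  case (Assign x e s)
  from Assign.prems show ?case by (rule AssignE) simp
next
  case (Write a i e s)
  from Write.prems show ?case by (rule WriteE) simp
next
  case (Seq c1 s t1 s1 c2 t2 s2)
  from Seq.prems show ?case
  proof (rule SeqE)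
    fix v1 r v2
    assume "u = v1 + v2" and 1: "exec c1 s v1 r" and 2: "exec c2 r v2 s''"
    moreover have "v1 = t1 \<and> r = s1" using Seq.IH(1)[OF 1] .
    moreover from this have "v2 = t2 \<and> s'' = s2" using Seq.IH(2)[of v2 s''] 2 by simp
    ultimately show ?thesis by simp
  qed
next
  case (CondTrue s b c1 t s' c2)
  from CondTrue.prems show ?case
  proof (rule CondE)
    fix v assume "u = Suc (bcost b + v)" "exec c1 s v s''"
    with CondTrue.IH[of v s''] show ?thesis by simp
  qed (use CondTrue.hyps in simp)
next
  case (CondFalse s b c2 t s' c1)
  from CondFalse.prems show ?case
  proof (rule CondE)
    fix v assume "u = Suc (bcost b + v)" "exec c2 s v s''"
    with CondFalse.IH[of v s''] show ?thesis by simp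
  qed (use CondFalse.hyps in simp)
next
  case (WhileFalse s b c)
  from WhileFalse.prems show ?case
    by (rule WhileE) (use WhileFalse.hyps in simp_all)
next
  case (WhileTrue s b c t1 s1 t2 s2)
  from WhileTrue.prems show ?case
  proof (rule WhileE)
    fix v1 r v2
    assume "u = Suc (bcost b + v1 + v2)" and 1: "exec c s v1 r" and 2: "exec (While b c) r v2 s''"
    moreover have "v1 = t1 \<and> r = s1" using WhileTrue.IH(1)[OF 1] .
    moreover from this have "v2 = t2 \<and> s'' = s2" using WhileTrue.IH(2)[of v2 s''] 2 by simp
    ultimately show ?thesis by simp
  qed (use WhileTrue.hyps in simp)
qed


section \<open>Encoding of the input and the output\<close>

text \<open>
  The vertices of an \<open>n\<close>-vertex input graph are numbered \<open>0, \<dots>, n - 1\<close>. The graph is given by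
  adjacency lists, in which the neighbours of a vertex may appear in any order.
\<close>

definition adjacency_lists :: "nat \<Rightarrow> nat set set \<Rightarrow> nat list list \<Rightarrow> bool" where
  "adjacency_lists n E adj \<longleftrightarrow> length adj = n \<and>
     (\<forall>v<n. distinct (adj ! v) \<and> set (adj ! v) = {u. {u, v} \<in> E})"

text \<open>
  Scalar 0 holds \<open>n\<close>. Array 1 holds the concatenation of the adjacency lists, in which the
  list of vertex \<open>v\<close> occupies the positions from \<open>off v\<close> to \<open>off (v + 1) - 1\<close>, where array 0
  holds the offsets \<open>off 0, \<dots>, off n\<close>. The rest of the memory is zero.
\<close>

definition input_state :: "nat \<Rightarrow> nat list list \<Rightarrow> state" where
  "input_state n adj = \<lparr>
     scalars = (\<lambda>_. 0)(0 := n),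
     arrays = (\<lambda>_ _. 0)
       (0 := (\<lambda>v. if v \<le> n then length (concat (take v adj)) else 0),
        1 := (\<lambda>i. if i < length (concat adj) then concat adj ! i else 0))\<rparr>"

text \<open>The output is the characteristic vector of a vertex set, in the first \<open>n\<close> cells of array 2.\<close>

definition output_set :: "nat \<Rightarrow> state \<Rightarrow> nat set" where
  "output_set n s = {v. v < n \<and> arrays s 2 v \<noteq> 0}"

end

theory Submission
  imports Defs
begin

text \<open>
  Remove the vertices one by one, always taking a vertex \<open>v\<close> with at most \<open>k\<close> remaining neighbours,
  where \<open>k\<close> starts at 0 and grows by 1 only if no such vertex exists; degeneracy keeps \<open>k \<le> d\<close>.
  If \<open>v\<close> is not yet dominated when it is removed, pick \<open>v\<close> and add all its remaining neighbours
  to the output (or \<open>v\<close> itself, if there are none). Each pick adds at most \<open>d\<close> vertices. Moreover at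
  most \<open>d\<close> picks lie in the closed neighbourhood of any vertex \<open>x\<close>: the first pick that is a
  neighbour of \<open>x\<close> removed before \<open>x\<close> puts \<open>x\<close> into the output; if \<open>x\<close> itself is picked, its remaining
  neighbours are put into the output; otherwise all these picks are among the at most \<open>d\<close> neighbours
  remaining when \<open>x\<close> is removed. So there are at most \<open>d\<close> picks per vertex of an optimal solution.
  Searching all vertices again for each value of \<open>k\<close> costs \<open>O(d n)\<close>, as does scanning the
  at most \<open>d n\<close> edges.
\<close>

section \<open>Neighbourhoods in degenerate graphs\<close>

definition nbs :: "'a set set \<Rightarrow> 'a \<Rightarrow> 'a set" where
  "nbs E v = {u. {u, v} \<in> E}"

lemma nbs_subset: "simple_graph V E \<Longrightarrow> nbs E v \<subseteq> V"
  by (auto simp: nbs_def simple_graph_def)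

lemma not_in_nbs_self: "simple_graph V E \<Longrightarrow> v \<notin> nbs E v"
  by (auto simp: nbs_def simple_graph_def)

lemma nbs_sym: "u \<in> nbs E v \<longleftrightarrow> v \<in> nbs E u"
  by (simp add: nbs_def insert_commute)

text \<open>Degeneracy applies to the subgraph induced on \<open>W\<close>, whose edges at
  \<open>v\<close> are at least as many as the neighbours of \<open>v\<close> in
  \<open>W\<close>.\<close>

lemma degenerate_low_degree_vertex:
  assumes G: "simple_graph V E" and "degenerate d V E" and W: "W \<subseteq> V" "W \<noteq> {}"
  shows "\<exists>v\<in>W. card (nbs E v \<inter> W) \<le> d"
proof -
  define F where "F = {e \<in> E. e \<subseteq> W}"
  have "subgraph W F V E"
    using G W by (auto simp: subgraph_def simple_graph_def F_def intro: finite_subset)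
  then obtain v where v: "v \<in> W" "degree F v \<le> d"
    using assms unfolding degenerate_def by blast
  have "finite W"
    using G W by (auto simp: simple_graph_def intro: finite_subset)
  have "finite {e \<in> F. v \<in> e}"
    by (rule finite_subset[of _ "Pow W"]) (use \<open>finite W\<close> in \<open>auto simp: F_def\<close>)
  moreover have "inj_on (\<lambda>u. {u, v}) (nbs E v \<inter> W)"
    by (auto simp: inj_on_def doubleton_eq_iff)
  moreover have "(\<lambda>u. {u, v}) ` (nbs E v \<inter> W) \<subseteq> {e \<in> F. v \<in> e}"
    using v by (auto simp: nbs_def F_def)
  ultimately have "card (nbs E v \<inter> W) \<le> degree F v"
    unfolding degree_def by (metis card_inj_on_le)
  with v show ?thesis by (meson order_trans)
qed

text \<open>Deleting a vertex with at most \<open>d\<close> neighbours in \<open>W\<close> costs its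
  own term and one from each of these neighbours, hence at most \<open>2 * d\<close>. This will
  bound the total length of the adjacency lists.\<close>

lemma degenerate_degree_sum:
  assumes G: "simple_graph V E" and deg: "degenerate d V E" and "W \<subseteq> V"
  shows "(\<Sum>v\<in>W. card (nbs E v \<inter> W)) \<le> 2 * d * card W"
  using \<open>W \<subseteq> V\<close>
proof (induction "card W" arbitrary: W)
  case 0
  then have "W = {}"
    using G by (auto simp: simple_graph_def dest: finite_subset)
  then show ?case by simp
next
  case (Suc m)
  have fin: "finite W" using Suc.prems G by (auto simp: simple_graph_def dest: finite_subset)
  obtain v where v: "v \<in> W" "card (nbs E v \<inter> W) \<le> d"
    using degenerate_low_degree_vertex[OF G deg Suc.prems] Suc.hyps(2) by fastforce
  let ?W = "W - {v}"
  have cardW: "card W = Suc (card ?W)" using fin v by (metis card.remove)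
  have "card (nbs E u \<inter> W) = card (nbs E u \<inter> ?W) + of_bool (u \<in> nbs E v)" if "u \<in> ?W" for u
  proof (cases "u \<in> nbs E v")
    case True
    then have "nbs E u \<inter> W = insert v (nbs E u \<inter> ?W)" using v nbs_sym[of u E v] by auto
    then show ?thesis using True fin by simp
  next
    case False
    then have "nbs E u \<inter> W = nbs E u \<inter> ?W" using nbs_sym[of u E v] by auto
    then show ?thesis using False by simp
  qed
  then have "(\<Sum>u\<in>?W. card (nbs E u \<inter> W))
      = (\<Sum>u\<in>?W. card (nbs E u \<inter> ?W)) + (\<Sum>u\<in>?W. of_bool (u \<in> nbs E v))"
    by (simp add: sum.distrib)
  also have "(\<Sum>u\<in>?W. of_bool (u \<in> nbs E v) :: nat) = card (nbs E v \<inter> ?W)"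
    using fin by (simp add: of_bool_def sum.If_cases Int_def conj_commute)
  also have "nbs E v \<inter> ?W = nbs E v \<inter> W" using not_in_nbs_self[OF G] by auto
  finally have "(\<Sum>u\<in>?W. card (nbs E u \<inter> W)) \<le> 2 * d * card ?W + d"
    using Suc.hyps(1)[of ?W] Suc.hyps(2) cardW Suc.prems v(2) by (simp add: subset_eq)
  then show ?case using v(2) cardW by (simp add: sum.remove[OF fin v(1)])
qed


section \<open>The charging argument\<close>

text \<open>
  \<open>R\<close> is the set of removed vertices, \<open>D\<close> the current output and \<open>U\<close> the set of picks. The last
  three conditions replace any reference to the order of removal.
\<close>

definition charging ::
  "'a set \<Rightarrow> 'a set set \<Rightarrow> nat \<Rightarrow> 'a set \<Rightarrow> 'a set \<Rightarrow> 'a set \<Rightarrow> bool" where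
  "charging V E d R D U \<longleftrightarrow> R \<subseteq> V \<and> D \<subseteq> V \<and> U \<subseteq> R \<and>
     (\<forall>r\<in>R. r \<in> D \<or> nbs E r \<inter> D \<noteq> {}) \<and>
     card D \<le> d * card U \<and>
     (\<forall>x\<in>V - R - D. U \<inter> insert x (nbs E x) = {}) \<and>
     (\<forall>x\<in>V. card (U \<inter> insert x (nbs E x)) \<le> d) \<and>
     (\<forall>x\<in>R - D. card (U \<inter> insert x (nbs E x)) + card (nbs E x - R - D) \<le> d)"

lemma charging_empty: "charging V E d {} {} {}"
  by (simp add: charging_def)

definition extend_dom :: "'a set set \<Rightarrow> 'a set \<Rightarrow> 'a \<Rightarrow> 'a set \<Rightarrow> 'a set" where
  "extend_dom E R v D =
     (if v \<in> D \<or> nbs E v \<inter> D \<noteq> {} then D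
      else if nbs E v \<subseteq> R then insert v D else D \<union> (nbs E v - R))"

text \<open>A new pick \<open>v\<close> changes the count only for \<open>x\<close> in its closed
  neighbourhood. As \<open>v\<close> is undominated, such an \<open>x\<close> is outside
  \<open>D\<close>: if not yet removed, its count goes from 0 to 1; if removed, \<open>v\<close>
  moves from its remaining neighbours to its picks, so the sum does not grow.\<close>

lemma charging_step:
  assumes G: "simple_graph V E" and d: "d \<ge> 1" and ch: "charging V E d R D U"
    and v: "v \<in> V" "v \<notin> R" and small: "card (nbs E v - R) \<le> d"
  shows "\<exists>U'. charging V E d (insert v R) (extend_dom E R v D) U'"
proof -
  have finV: "finite V" using G by (simp add: simple_graph_def)
  have N: "\<And>x. nbs E x \<subseteq> V" "\<And>x. finite (nbs E x)"
    using nbs_subset[OF G] finV finite_subset by metis+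
  have RDU: "R \<subseteq> V" "D \<subseteq> V" "U \<subseteq> R" and fin: "finite U" "finite D" "finite R"
    using ch finV by (auto simp: charging_def intro: finite_subset)
  have dom: "\<And>r. r \<in> R \<Longrightarrow> r \<in> D \<or> nbs E r \<inter> D \<noteq> {}"
    and cardD: "card D \<le> d * card U"
    and none: "\<And>x. x \<in> V \<Longrightarrow> x \<notin> R \<Longrightarrow> x \<notin> D \<Longrightarrow> U \<inter> insert x (nbs E x) = {}"
    and few: "\<And>x. x \<in> V \<Longrightarrow> card (U \<inter> insert x (nbs E x)) \<le> d"
    and rest: "\<And>x. x \<in> R \<Longrightarrow> x \<notin> D \<Longrightarrow>
      card (U \<inter> insert x (nbs E x)) + card (nbs E x - R - D) \<le> d"
    using ch by (auto simp: charging_def)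
  show ?thesis
  proof (cases "v \<in> D \<or> nbs E v \<inter> D \<noteq> {}")
    case True
    then have ext: "extend_dom E R v D = D" by (simp add: extend_dom_def)
    have "card (U \<inter> insert x (nbs E x)) + card (nbs E x - insert v R - D) \<le> d"
      if "x \<in> insert v R" "x \<notin> D" for x
    proof (cases "x = v")
      case True
      \<comment> \<open>The last condition of \<open>charging\<close> now concerns \<open>v\<close>
        as well: it has no picks nearby by \<open>none\<close>, and at most \<open>d\<close>
        remaining neighbours by \<open>small\<close>.\<close>
      have "card (nbs E v - insert v R - D) \<le> card (nbs E v - R)"
        using N by (intro card_mono) auto
      then show ?thesis using none[of v] v True that small by simp
    next
      case False
      have "card (nbs E x - insert v R - D) \<le> card (nbs E x - R - D)"
        using N by (intro card_mono) auto
      then show ?thesis using rest[of x] False that by auto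
    qed
    then have "charging V E d (insert v R) D U"
      unfolding charging_def using RDU v dom True cardD none few by auto
    then show ?thesis using ext by auto
  next
    case False
    then have vD: "v \<notin> D" and ND: "nbs E v \<inter> D = {}" by auto
    define A where "A = (if nbs E v \<subseteq> R then {v} else nbs E v - R)"
    have ext: "extend_dom E R v D = D \<union> A" using False by (auto simp: extend_dom_def A_def)
    have A: "A \<subseteq> V" "A \<inter> R = {}" "finite A" "A \<noteq> {}" "A \<subseteq> insert v (nbs E v)" "nbs E v - R \<subseteq> A"
      using N v by (auto simp: A_def)
    have cardA: "card A \<le> d" using d small by (auto simp: A_def)
    have vU: "v \<notin> U" using RDU v by auto
    have only: "insert v U \<inter> insert x (nbs E x) = {v}"
      if "x \<in> V" "x \<notin> R" "x \<notin> D" "x \<in> insert v (nbs E v)" for x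
      using none[OF that(1-3)] that(4) nbs_sym[of x E v] by auto
    have same: "insert v U \<inter> insert x (nbs E x) = U \<inter> insert x (nbs E x)"
      if "x \<notin> insert v (nbs E v)" for x
      using that nbs_sym[of x E v] by auto
    have grow: "card (insert v U \<inter> insert x (nbs E x)) + card (nbs E x - insert v R - (D \<union> A)) \<le> d"
      if x: "x \<in> insert v R" "x \<notin> D \<union> A" for x
    proof -
      consider "x = v" | "x \<in> R" "x \<in> nbs E v" | "x \<in> R" "x \<notin> nbs E v" "x \<noteq> v" using x by auto
      then show ?thesis
      proof cases
        case 1
        have "nbs E v - insert v R - (D \<union> A) = {}" using A by auto
        then have "card (nbs E v - insert v R - (D \<union> A)) = 0" by (metis card.empty)
        moreover have "card (insert v U \<inter> insert v (nbs E v)) = 1"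
          by (subst only) (use v vD in auto)
        ultimately show ?thesis using 1 d by simp
      next
        case 2
        \<comment> \<open>The pick \<open>v\<close> no longer counts as a remaining neighbour of
          \<open>x\<close>, which makes up for the additional pick.\<close>
        have vx: "v \<in> nbs E x" using 2 nbs_sym by metis
        have "insert v U \<inter> insert x (nbs E x) = insert v (U \<inter> insert x (nbs E x))" using vx by auto
        then have c1: "card (insert v U \<inter> insert x (nbs E x)) = Suc (card (U \<inter> insert x (nbs E x)))"
          using vU fin by simp
        have "card (nbs E x - insert v R - (D \<union> A)) \<le> card (nbs E x - R - D - {v})"
          using N by (intro card_mono) auto
        also have "\<dots> < card (nbs E x - R - D)"
          using vx v vD N by (intro card_Diff1_less) auto
        finally show ?thesis using c1 rest[of x] 2 x by auto
      next
        case 3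
        have "card (nbs E x - insert v R - (D \<union> A)) \<le> card (nbs E x - R - D)"
          using N by (intro card_mono) auto
        then show ?thesis using same[of x] 3 rest[of x] x by auto
      qed
    qed
    have few': "card (insert v U \<inter> insert x (nbs E x)) \<le> d" if "x \<in> V" for x
    proof -
      consider "x \<notin> insert v (nbs E v)" | "x \<in> insert v (nbs E v)" "x \<notin> R"
        | "x \<in> nbs E v" "x \<in> R" using v by auto
      then show ?thesis
      proof cases
        case 1
        then show ?thesis using same few that by simp
      next
        case 2
        then have "x \<notin> D" using vD ND by auto
        then have "card (insert v U \<inter> insert x (nbs E x)) = 1"
          by (subst only) (use 2 that in auto)
        then show ?thesis using d by simp
      next
        case 3
        then have "x \<notin> D \<union> A" using ND A by auto
        then show ?thesis using grow[of x] 3 by simp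
      qed
    qed
    have dom': "r \<in> D \<union> A \<or> nbs E r \<inter> (D \<union> A) \<noteq> {}" if "r \<in> insert v R" for r
      using that dom A by blast
    have none': "insert v U \<inter> insert x (nbs E x) = {}" if "x \<in> V - insert v R - (D \<union> A)" for x
    proof -
      \<comment> \<open>All remaining neighbours of \<open>v\<close> have entered
        \<open>A\<close>.\<close>
      have "x \<notin> insert v (nbs E v)" using that A by auto
      then show ?thesis using same[of x] none[of x] that by auto
    qed
    have "card (D \<union> A) \<le> d * card (insert v U)"
      using cardD cardA card_Un_le[of D A] vU fin by simp
    then have "charging V E d (insert v R) (D \<union> A) (insert v U)"
      unfolding charging_def using RDU v A dom' none' few' grow by auto
    then show ?thesis using ext by auto
  qed
qed

text \<open>The closed neighbourhoods of an optimal solution cover all picks, with at most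
  \<open>d\<close> picks in each; every pick accounts for at most \<open>d\<close> output vertices,
  which gives the second factor \<open>d\<close>.\<close>

lemma charging_complete:
  assumes G: "simple_graph V E" and ch: "charging V E d V D U"
  shows "dominating_set V E D" and "card D \<le> d\<^sup>2 * domination_number V E"
proof -
  have finV: "finite V" using G by (simp add: simple_graph_def)
  show dom: "dominating_set V E D"
    using ch by (fastforce simp: charging_def dominating_set_def nbs_def)
  have fin: "finite {S. dominating_set V E S}"
    by (rule finite_subset[of _ "Pow V"]) (use finV in \<open>auto simp: dominating_set_def\<close>)
  \<comment> \<open>The minimum is attained because \<open>D\<close> itself is a candidate.\<close>
  have "Min (card ` {S. dominating_set V E S}) \<in> card ` {S. dominating_set V E S}"
    using fin dom by (intro Min_in) auto
  then obtain S where S: "dominating_set V E S" "card S = domination_number V E"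
    unfolding domination_number_def by auto
  have SV: "S \<subseteq> V" "finite S" using S finV by (auto simp: dominating_set_def intro: finite_subset)
  have "\<exists>x\<in>S. u \<in> insert x (nbs E x)" if "u \<in> U" for u
  proof -
    have "u \<in> V" using that ch by (auto simp: charging_def)
    then have "u \<in> S \<or> (\<exists>x\<in>S. {x, u} \<in> E)" using S by (simp add: dominating_set_def)
    then show ?thesis by (auto simp: nbs_def insert_commute)
  qed
  then have "U = (\<Union>x\<in>S. U \<inter> insert x (nbs E x))" by blast
  then have "card U \<le> (\<Sum>x\<in>S. card (U \<inter> insert x (nbs E x)))"
    using card_UN_le[OF SV(2)] by metis
  also have "\<dots> \<le> card S * d"
  proof -
    have "card (U \<inter> insert x (nbs E x)) \<le> d" if "x \<in> S" for x
      using that ch SV by (simp add: charging_def subset_eq)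
    then show ?thesis
      using sum_bounded_above[of S "\<lambda>x. card (U \<inter> insert x (nbs E x))" d] by simp
  qed
  finally have "d * card U \<le> d * (card S * d)" by simp
  moreover have "card D \<le> d * card U" using ch by (simp add: charging_def)
  ultimately have "card D \<le> d * (card S * d)" by (rule order_trans[rotated])
  then show "card D \<le> d\<^sup>2 * domination_number V E"
    using S by (simp add: power2_eq_square ac_simps)
qed


section \<open>Total correctness with running times\<close>

text \<open>The postcondition also sees the running time, so correctness and cost are proved
  together. Runs are deterministic, so the existential speaks of the only run.\<close>

definition wp :: "com \<Rightarrow> state \<Rightarrow> (nat \<Rightarrow> state \<Rightarrow> bool) \<Rightarrow> bool" where
  "wp c s Q \<longleftrightarrow> (\<exists>t s'. exec c s t s' \<and> Q t s')"

lemma wp_Skip: "wp Skip s Q \<longleftrightarrow> Q 1 s"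
  unfolding wp_def by (metis exec.Skip exec_deterministic)

lemma wp_Assign:
  "wp (Assign x e) s Q \<longleftrightarrow> Q (1 + ecost e) (s\<lparr>scalars := (scalars s)(x := eval s e)\<rparr>)"
  unfolding wp_def by (metis exec.Assign exec_deterministic)

lemma wp_Write:
  "wp (Write a i e) s Q \<longleftrightarrow> Q (1 + ecost i + ecost e)
     (s\<lparr>arrays := (arrays s)(a := (arrays s a)(eval s i := eval s e))\<rparr>)"
  unfolding wp_def by (metis exec.Write exec_deterministic)

lemma wp_Seq: "wp (Seq c1 c2) s Q \<longleftrightarrow> wp c1 s (\<lambda>t1 s1. wp c2 s1 (\<lambda>t2. Q (t1 + t2)))"
  unfolding wp_def by (blast intro: exec.Seq elim: SeqE)

lemma wp_Cond:
  "wp (Cond b c1 c2) s Q \<longleftrightarrow>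
     (if beval s b then wp c1 s (\<lambda>t. Q (1 + bcost b + t)) else wp c2 s (\<lambda>t. Q (1 + bcost b + t)))"
proof -
  have "exec (Cond b c1 c2) s t s' \<longleftrightarrow>
      (\<exists>u. t = 1 + bcost b + u \<and> exec (if beval s b then c1 else c2) s u s')" for t s'
    by (auto intro: exec.CondTrue[simplified] exec.CondFalse[simplified] elim: CondE)
  then show ?thesis unfolding wp_def by auto
qed

lemmas wp_simps = wp_Skip wp_Assign wp_Write wp_Seq wp_Cond

lemma wp_mono: "wp c s P \<Longrightarrow> (\<And>t s'. P t s' \<Longrightarrow> Q t s') \<Longrightarrow> wp c s Q"
  unfolding wp_def by blast

text \<open>The potential gives termination and pays for each iteration; strictness of the
  inequality covers the extra unit charged by \<open>WhileTrue\<close>.\<close>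

lemma wp_While_potential:
  fixes pot :: "state \<Rightarrow> nat"
  assumes step: "\<And>s. I s \<Longrightarrow> beval s b \<Longrightarrow>
      wp c s (\<lambda>t s'. I s' \<and> pot s' + t + bcost b < pot s)"
    and "I s"
  shows "wp (While b c) s (\<lambda>t s'. I s' \<and> \<not> beval s' b \<and> t \<le> pot s + 1 + bcost b)"
  using \<open>I s\<close>
proof (induction "pot s" arbitrary: s rule: less_induct)
  case less
  show ?case
  proof (cases "beval s b")
    case False
    then show ?thesis
      using less.prems exec.WhileFalse[OF False, of c] unfolding wp_def by fastforce
  next
    case True
    then obtain t s' where s': "exec c s t s'" "I s'" "pot s' + t + bcost b < pot s"
      using step[OF less.prems] unfolding wp_def by auto
    then obtain u s'' where "exec (While b c) s' u s''" "I s''" "\<not> beval s'' b"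
        "u \<le> pot s' + 1 + bcost b"
      using less.hyps[of s'] unfolding wp_def by auto
    then show ?thesis
      using exec.WhileTrue[OF True s'(1)] s'(3) unfolding wp_def by fastforce
  qed
qed

text \<open>\<open>S x\<close> is the state after \<open>x\<close> iterations in closed form. The
  last of the \<open>m + 1\<close> tests is charged for a body too, to make the bound a
  product.\<close>

lemma wp_While_for:
  assumes step: "\<And>x. x < m \<Longrightarrow> beval (S x) b \<and> wp c (S x) (\<lambda>t s'. s' = S (Suc x) \<and> t \<le> T)"
    and stop: "\<not> beval (S m) b"
  shows "wp (While b c) (S 0) (\<lambda>t s'. s' = S m \<and> t \<le> (m + 1) * (1 + bcost b + T))"
proof -
  have "wp (While b c) (S (m - x)) (\<lambda>t s'. s' = S m \<and> t \<le> (x + 1) * (1 + bcost b + T))"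
    if "x \<le> m" for x
    using that
  proof (induction x)
    case 0
    then show ?case
      using exec.WhileFalse[OF stop, of c] unfolding wp_def by fastforce
  next
    case (Suc x)
    have less: "m - Suc x < m" and Sx: "Suc (m - Suc x) = m - x" using Suc.prems by auto
    obtain t where t: "exec c (S (m - Suc x)) t (S (m - x))" "t \<le> T"
      using step[OF less] Sx unfolding wp_def by auto
    moreover obtain u where u: "exec (While b c) (S (m - x)) u (S m)"
        "u \<le> (x + 1) * (1 + bcost b + T)"
      using Suc unfolding wp_def by auto
    ultimately have "exec (While b c) (S (m - Suc x)) (1 + bcost b + t + u) (S m)"
      using step[OF less] exec.WhileTrue by blast
    moreover have "1 + bcost b + t + u \<le> (Suc x + 1) * (1 + bcost b + T)"
      using t u by simp
    ultimately show ?case unfolding wp_def by blast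
  qed
  from this[of m] show ?thesis by simp
qed


section \<open>The program\<close>

text \<open>
  Scalar 1 counts the removed vertices, scalar 2 is the height of the stack in array 5,
  scalar 3 is the cursor of the search for vertices of remaining degree at most the threshold in
  scalar 4. Array 3 marks removed vertices, array 4 counts the removed neighbours of a vertex.
  Vertices are pushed without any test and filtered when they are popped; the cursor only moves
  while the stack is empty.
\<close>

definition sum_dom_loop :: com where
  "sum_dom_loop = While (Less (Var 7) (Read 0 (Plus (Var 5) (Num 1))))
     (Seq (Assign 6 (Plus (Var 6) (Read 2 (Read 1 (Var 7)))))
          (Assign 7 (Plus (Var 7) (Num 1))))"

text \<open>Scalar 5 is the vertex being removed, scalar 7 the position in its list, and scalar 6
  the sum of the output marks on its closed neighbourhood, zero iff it is undominated. Neighbours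
  are pushed because their remaining degree drops.\<close>

definition push_loop :: com where
  "push_loop = While (Less (Var 7) (Read 0 (Plus (Var 5) (Num 1))))
     (Seq (Write 4 (Read 1 (Var 7)) (Plus (Read 4 (Read 1 (Var 7))) (Num 1)))
     (Seq (Write 5 (Var 2) (Read 1 (Var 7)))
     (Seq (Assign 2 (Plus (Var 2) (Num 1)))
     (Seq (Cond (Conj (Equal (Var 6) (Num 0)) (Equal (Read 3 (Read 1 (Var 7))) (Num 0)))
            (Write 2 (Read 1 (Var 7)) (Num 1)) Skip)
          (Assign 7 (Plus (Var 7) (Num 1)))))))"

text \<open>The final test compares the list length with the counter in array 4: it succeeds iff no
  neighbour remains.\<close>

definition remove_vertex :: com where
  "remove_vertex =
     Seq (Write 3 (Var 5) (Num 1))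
    (Seq (Assign 1 (Plus (Var 1) (Num 1)))
    (Seq (Assign 6 (Read 2 (Var 5)))
    (Seq (Assign 7 (Read 0 (Var 5)))
    (Seq sum_dom_loop
    (Seq (Assign 7 (Read 0 (Var 5)))
    (Seq push_loop
    (Cond (Conj (Equal (Var 6) (Num 0))
                (Equal (Read 0 (Plus (Var 5) (Num 1))) (Plus (Read 0 (Var 5)) (Read 4 (Var 5)))))
       (Write 2 (Var 5) (Num 1)) Skip)))))))"

text \<open>The branches pop a candidate, push the vertex at the cursor, or raise the threshold and
  restart the search. The comparison of offsets says that the remaining degree is at most the
  threshold.\<close>

definition peel_body :: com where
  "peel_body =
     Cond (Less (Num 0) (Var 2))
      (Seq (Assign 2 (Minus (Var 2) (Num 1)))
      (Seq (Assign 5 (Read 5 (Var 2)))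
      (Cond (Conj (Equal (Read 3 (Var 5)) (Num 0))
               (Less (Read 0 (Plus (Var 5) (Num 1)))
                 (Plus (Plus (Read 0 (Var 5)) (Read 4 (Var 5))) (Plus (Var 4) (Num 1)))))
        remove_vertex Skip)))
      (Cond (Less (Var 3) (Var 0))
        (Seq (Write 5 (Var 2) (Var 3))
        (Seq (Assign 2 (Plus (Var 2) (Num 1)))
             (Assign 3 (Plus (Var 3) (Num 1)))))
        (Seq (Assign 4 (Plus (Var 4) (Num 1)))
             (Assign 3 (Num 0))))"

definition peel :: com where
  "peel = While (Less (Var 1) (Var 0)) peel_body"

section \<open>The input graph in memory and the removal of one vertex\<close>

locale adjacency_input =
  fixes n d :: nat and E :: "nat set set" and adj :: "nat list list"
  assumes graph: "simple_graph {..<n} E" and d_pos: "d \<ge> 1"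
    and degen: "degenerate d {..<n} E" and lists: "adjacency_lists n E adj"
begin

definition off :: "nat \<Rightarrow> nat" where
  "off = arrays (input_state n adj) 0"

definition nbr :: "nat \<Rightarrow> nat" where
  "nbr = arrays (input_state n adj) 1"

lemma len_adj: "length adj = n"
  using lists by (simp add: adjacency_lists_def)

lemma set_adj: "v < n \<Longrightarrow> set (adj ! v) = nbs E v"
  and distinct_adj: "v < n \<Longrightarrow> distinct (adj ! v)"
  using lists by (auto simp: adjacency_lists_def nbs_def)

lemma nbs_less: "u \<in> nbs E v \<Longrightarrow> u < n"
  using nbs_subset[OF graph] by auto

lemma finite_nbs: "finite (nbs E v)"
  using nbs_subset[OF graph] finite_subset by blast

lemma length_adj: "v < n \<Longrightarrow> length (adj ! v) = card (nbs E v)"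
  using set_adj distinct_adj distinct_card by metis

lemma concat_take_Suc:
  assumes "v < n"
  shows "concat (take (Suc v) adj) = concat (take v adj) @ adj ! v"
  using assms len_adj by (simp add: take_Suc_conv_app_nth)

lemma off_Suc: "v < n \<Longrightarrow> off (Suc v) = off v + length (adj ! v)"
  by (simp add: off_def input_state_def concat_take_Suc)

lemma nbr_off:
  assumes v: "v < n" and x: "x < length (adj ! v)"
  shows "nbr (off v + x) = adj ! v ! x"
proof -
  have "concat adj = (concat (take v adj) @ adj ! v) @ concat (drop (Suc v) adj)"
    unfolding concat_take_Suc[OF v, symmetric] by (metis append_take_drop_id concat_append)
  then show ?thesis
    using v x by (simp add: nbr_def off_def input_state_def nth_append)
qed

lemma wp_sum_dom_loop:
  assumes v: "scalars s 5 = v" "v < n" and arr: "arrays s 0 = off" "arrays s 1 = nbr"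
    and j: "scalars s 7 = off v"
  shows "wp sum_dom_loop s (\<lambda>t s'. s' = s\<lparr>scalars := (scalars s)
      (6 := scalars s 6 + (\<Sum>x<length (adj ! v). arrays s 2 (adj ! v ! x)), 7 := off (Suc v))\<rparr>
      \<and> t \<le> (length (adj ! v) + 1) * 20)"
proof -
  define S where "S x = s\<lparr>scalars := (scalars s)
      (6 := scalars s 6 + (\<Sum>y<x. arrays s 2 (adj ! v ! y)), 7 := off v + x)\<rparr>" for x
  have S0: "S 0 = s" using j by (simp add: S_def fun_upd_idem)
  show ?thesis
    unfolding sum_dom_loop_def
    apply (rule wp_mono)
     \<comment> \<open>The test costs 6 and the body 10, so \<open>T = 12\<close> suffices and
       \<open>1 + 6 + 12\<close> stays below 20.\<close>
     apply (rule wp_While_for[where S = S and m = "length (adj ! v)" and T = 12, unfolded S0])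
      apply (simp_all add: S_def wp_simps v arr arr[unfolded One_nat_def] off_Suc nbr_off add.assoc)
    done
qed

lemma wp_push_loop:
  assumes v: "scalars s 5 = v" "v < n" and arr: "arrays s 0 = off" "arrays s 1 = nbr"
    and j: "scalars s 7 = off v"
  shows "wp push_loop s (\<lambda>t s'. s' = s\<lparr>
      scalars := (scalars s)(2 := scalars s 2 + length (adj ! v), 7 := off (Suc v)),
      arrays := (arrays s)
        (2 := (\<lambda>u. if scalars s 6 = 0 \<and> arrays s 3 u = 0 \<and> u \<in> nbs E v then 1
                   else arrays s 2 u),
         4 := (\<lambda>u. arrays s 4 u + of_bool (u \<in> nbs E v)),
         5 := (\<lambda>p. if scalars s 2 \<le> p \<and> p < scalars s 2 + length (adj ! v)
                   then adj ! v ! (p - scalars s 2) else arrays s 5 p))\<rparr>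
      \<and> t \<le> (length (adj ! v) + 1) * 50)"
proof -
  define S where "S x = s\<lparr>
      scalars := (scalars s)(2 := scalars s 2 + x, 7 := off v + x),
      arrays := (arrays s)
        (2 := (\<lambda>u. if scalars s 6 = 0 \<and> arrays s 3 u = 0 \<and> u \<in> set (take x (adj ! v)) then 1
                   else arrays s 2 u),
         4 := (\<lambda>u. arrays s 4 u + of_bool (u \<in> set (take x (adj ! v)))),
         5 := (\<lambda>p. if scalars s 2 \<le> p \<and> p < scalars s 2 + x
                   then adj ! v ! (p - scalars s 2) else arrays s 5 p))\<rparr>" for x
  have S0: "S 0 = s"
    using j by (auto simp: S_def fun_eq_iff intro!: state.equality)
  \<comment> \<open>Distinctness of the list ensures that each neighbour is counted only once in
    array 4.\<close>
  have new: "adj ! v ! x \<notin> set (take x (adj ! v))" if "x < length (adj ! v)" for x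
    using distinct_adj[OF v(2)] that by (auto simp: in_set_conv_nth nth_eq_iff_index_eq)
  have insert_take: "set (take (Suc x) (adj ! v)) = insert (adj ! v ! x) (set (take x (adj ! v)))"
    if "x < length (adj ! v)" for x
    using that by (simp add: take_Suc_conv_app_nth)
  show ?thesis
    unfolding push_loop_def
    apply (rule wp_mono)
     apply (rule wp_While_for[where S = S and m = "length (adj ! v)" and T = 42, unfolded S0])
    subgoal for x
      using new[of x]
      apply (simp add: S_def wp_simps v arr arr[unfolded One_nat_def] off_Suc nbr_off insert_take)
      apply (intro conjI impI state.equality ext)
      apply (auto split: if_splits)
      apply (metis add_diff_cancel_left')+
      done
     apply (simp_all add: S_def v arr off_Suc set_adj)
    done
qed

lemma wp_remove_vertex:
  assumes v: "scalars s 5 = v" "v < n" and arr: "arrays s 0 = off" "arrays s 1 = nbr"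
  shows "wp remove_vertex s (\<lambda>t s'.
      scalars s' 0 = scalars s 0 \<and> scalars s' 1 = scalars s 1 + 1 \<and>
      scalars s' 2 = scalars s 2 + length (adj ! v) \<and>
      scalars s' 3 = scalars s 3 \<and> scalars s' 4 = scalars s 4 \<and>
      arrays s' 0 = off \<and> arrays s' 1 = nbr \<and>
      arrays s' 2 = (\<lambda>u.
        if arrays s 2 v + (\<Sum>x<length (adj ! v). arrays s 2 (adj ! v ! x)) = 0 \<and>
           (if u = v then arrays s 4 v = length (adj ! v) else arrays s 3 u = 0 \<and> u \<in> nbs E v)
        then 1 else arrays s 2 u) \<and>
      arrays s' 3 = (arrays s 3)(v := 1) \<and>
      arrays s' 4 = (\<lambda>u. arrays s 4 u + of_bool (u \<in> nbs E v)) \<and>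
      arrays s' 5 = (\<lambda>p. if scalars s 2 \<le> p \<and> p < scalars s 2 + length (adj ! v)
        then adj ! v ! (p - scalars s 2) else arrays s 5 p) \<and>
      t \<le> 120 * (length (adj ! v) + 1))"
  unfolding remove_vertex_def
  apply (simp only: wp_Seq wp_Assign wp_Write)
  apply (rule wp_mono, rule wp_sum_dom_loop[where v = v])
       apply (simp_all add: v arr arr[unfolded One_nat_def])
  apply (rule wp_mono, rule wp_push_loop[where v = v])
       apply (simp_all add: v arr arr[unfolded One_nat_def])
  \<comment> \<open>As \<open>v\<close> is not its own neighbour, its counter in array 4 still has
    the old value at the final test.\<close>
  apply (auto simp: wp_simps v arr arr[unfolded One_nat_def] off_Suc not_in_nbs_self[OF graph] fun_eq_iff)
  done

section \<open>Invariant and potential of the main loop\<close>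

definition removed :: "state \<Rightarrow> nat set" where
  "removed s = {v. v < n \<and> arrays s 3 v \<noteq> 0}"

text \<open>The last condition justifies raising the threshold: no low-degree vertex behind the
  cursor is missing from the stack. The stack may also hold duplicates and removed vertices.\<close>

definition peel_inv :: "state \<Rightarrow> bool" where
  "peel_inv s \<longleftrightarrow> scalars s 0 = n \<and> arrays s 0 = off \<and> arrays s 1 = nbr \<and>
     scalars s 1 = card (removed s) \<and>
     (\<exists>U. charging {..<n} E d (removed s) (output_set n s) U) \<and>
     (\<forall>u<n. arrays s 4 u = card (nbs E u \<inter> removed s)) \<and>
     scalars s 4 \<le> d \<and> scalars s 3 \<le> n \<and>
     (\<forall>p<scalars s 2. arrays s 5 p < n) \<and>
     (\<forall>u<scalars s 3. u \<notin> removed s \<longrightarrow> card (nbs E u - removed s) \<le> scalars s 4 \<longrightarrow>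
        (\<exists>p<scalars s 2. arrays s 5 p = u))"

text \<open>
  Removing \<open>v\<close> pushes all its neighbours, hence the factor 2 of the degrees; advancing the cursor
  pushes one vertex, hence the factor 2 of the distance to the end.
\<close>

definition pot :: "state \<Rightarrow> nat" where
  "pot s = 200 * ((\<Sum>v\<in>{..<n} - removed s. 2 * card (nbs E v) + 1) + scalars s 2 +
     2 * (n - scalars s 3) + (d - scalars s 4) * (2 * n + 1))"

text \<open>This links the array update to \<open>extend_dom\<close>: a sum of marks vanishes iff
  all marks do, and the counter equals the list length iff all neighbours are removed.\<close>

lemma output_set_remove_vertex:
  assumes "v < n" "arrays s 4 v = card (nbs E v \<inter> removed s)" "v \<notin> removed s"
    and D': "arrays s' 2 = (\<lambda>u.
        if arrays s 2 v + (\<Sum>x<length (adj ! v). arrays s 2 (adj ! v ! x)) = 0 \<and>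
           (if u = v then arrays s 4 v = length (adj ! v) else arrays s 3 u = 0 \<and> u \<in> nbs E v)
        then 1 else arrays s 2 u)"
  shows "output_set n s' = extend_dom E (removed s) v (output_set n s)"
proof -
  let ?R = "removed s" and ?D = "output_set n s"
  have "(\<Sum>x<length (adj ! v). arrays s 2 (adj ! v ! x)) = 0
      \<longleftrightarrow> (\<forall>u\<in>nbs E v. arrays s 2 u = 0)"
    unfolding set_adj[OF \<open>v < n\<close>, symmetric] all_set_conv_all_nth by auto
  then have f: "arrays s 2 v + (\<Sum>x<length (adj ! v). arrays s 2 (adj ! v ! x)) = 0
      \<longleftrightarrow> \<not> (v \<in> ?D \<or> nbs E v \<inter> ?D \<noteq> {})"
    using \<open>v < n\<close> nbs_less by (auto simp: output_set_def)
  have "card (nbs E v \<inter> ?R) = card (nbs E v) \<longleftrightarrow> nbs E v \<inter> ?R = nbs E v"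
    using finite_nbs[of v] by (metis Int_lower1 card_subset_eq)
  then have g: "arrays s 4 v = length (adj ! v) \<longleftrightarrow> nbs E v \<subseteq> ?R"
    using assms length_adj by auto
  have r: "arrays s 3 u = 0 \<longleftrightarrow> u \<notin> ?R" if "u \<in> nbs E v" for u
    using that nbs_less by (auto simp: removed_def)
  show ?thesis
  proof (cases "v \<in> ?D \<or> nbs E v \<inter> ?D \<noteq> {}")
    case True
    then show ?thesis
      unfolding extend_dom_def output_set_def D' f by (simp add: output_set_def)
  next
    case False
    have "u \<in> output_set n s' \<longleftrightarrow>
        u \<in> ?D \<or> (if u = v then nbs E v \<subseteq> ?R else u \<in> nbs E v - ?R)" for u
      unfolding output_set_def D' f g using False r[of u] nbs_less[of u v] \<open>v < n\<close>
      by (auto simp: output_set_def)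
    then show ?thesis
      using False not_in_nbs_self[OF graph, of v] by (auto simp: extend_dom_def split: if_splits)
  qed
qed

lemma card_nbs_split: "card (nbs E u) = card (nbs E u \<inter> R) + card (nbs E u - R)"
  using finite_nbs[of u] by (metis card_Int_Diff)

lemma removed_less: "removed s \<subseteq> {..<n}" "finite (removed s)"
  by (auto simp: removed_def)

text \<open>With \<open>c\<close> neighbours of \<open>v\<close>, removal releases
  \<open>2 * c + 1\<close> units of 200 and the pop one more, while the pushes take
  \<open>c\<close>. The remaining \<open>c + 2\<close> units cover \<open>120 * (c + 1)\<close> and
  50 for the pop and the tests.\<close>

lemma peel_inv_remove_vertex:
  assumes inv: "peel_inv s" and sp: "scalars s 2 > 0" and v: "v = arrays s 5 (scalars s 2 - 1)"
    and low: "v \<notin> removed s" "card (nbs E v - removed s) \<le> scalars s 4"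
    and s1: "s1 = s\<lparr>scalars := (scalars s)(2 := scalars s 2 - 1, 5 := v)\<rparr>"
  shows "wp remove_vertex s1 (\<lambda>t s'. peel_inv s' \<and> pot s' + t + 50 \<le> pot s)"
proof -
  let ?R = "removed s" and ?D = "output_set n s" and ?sp = "scalars s 2" and ?c = "card (nbs E v)"
  have vn: "v < n" using inv sp by (simp add: peel_inv_def v)
  have s1_simps: "removed s1 = ?R" "output_set n s1 = ?D" "arrays s1 = arrays s"
    by (simp_all add: s1 removed_def output_set_def)
  have arr: "arrays s1 0 = off" "arrays s1 1 = nbr" and "scalars s1 5 = v"
    using inv by (simp_all add: peel_inv_def s1)
  note len = length_adj[OF vn]
  have goal: "peel_inv s' \<and> pot s' + t + 50 \<le> pot s"
    if P: "scalars s' 0 = scalars s1 0" "scalars s' 1 = scalars s1 1 + 1"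
      "scalars s' 2 = scalars s1 2 + length (adj ! v)"
      "scalars s' 3 = scalars s1 3" "scalars s' 4 = scalars s1 4"
      "arrays s' 0 = off" "arrays s' 1 = nbr"
      "arrays s' 2 = (\<lambda>u.
        if arrays s1 2 v + (\<Sum>x<length (adj ! v). arrays s1 2 (adj ! v ! x)) = 0 \<and>
           (if u = v then arrays s1 4 v = length (adj ! v) else arrays s1 3 u = 0 \<and> u \<in> nbs E v)
        then 1 else arrays s1 2 u)"
      "arrays s' 3 = (arrays s1 3)(v := 1)"
      "arrays s' 4 = (\<lambda>u. arrays s1 4 u + of_bool (u \<in> nbs E v))"
      "arrays s' 5 = (\<lambda>p. if scalars s1 2 \<le> p \<and> p < scalars s1 2 + length (adj ! v)
        then adj ! v ! (p - scalars s1 2) else arrays s1 5 p)"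
      and t: "t \<le> 120 * (length (adj ! v) + 1)" for t s'
  proof -
    have dec: "arrays s 4 u = card (nbs E u \<inter> ?R)" if "u < n" for u
      using inv that by (simp add: peel_inv_def)
    have R': "removed s' = insert v ?R"
      using P(9) vn by (auto simp: removed_def s1)
    have D': "output_set n s' = extend_dom E ?R v ?D"
      using output_set_remove_vertex[of v s1 s'] P(8) vn low dec[OF vn] by (simp add: s1_simps)
    obtain U where "charging {..<n} E d ?R ?D U" using inv by (auto simp: peel_inv_def)
    then have ch: "\<exists>U. charging {..<n} E d (insert v ?R) (extend_dom E ?R v ?D) U"
      using inv low vn by (intro charging_step[OF graph d_pos]) (auto simp: peel_inv_def)
    have dec': "arrays s' 4 u = card (nbs E u \<inter> insert v ?R)" if "u < n" for u
    proof (cases "u \<in> nbs E v")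
      case True
      then have "nbs E u \<inter> insert v ?R = insert v (nbs E u \<inter> ?R)" using nbs_sym[of u E v] by auto
      then show ?thesis using True low dec[OF that] finite_nbs P(10) by (simp add: s1_simps)
    next
      case False
      then have "nbs E u \<inter> insert v ?R = nbs E u \<inter> ?R" using nbs_sym[of u E v] by auto
      then show ?thesis using False dec[OF that] P(10) by (simp add: s1_simps)
    qed
    have stack: "arrays s' 5 p < n" if "p < scalars s' 2" for p
    proof (cases "p < ?sp - 1")
      case True
      then show ?thesis using inv P(11) by (simp add: peel_inv_def s1)
    next
      case False
      then have p: "?sp - 1 \<le> p" "p < ?sp - 1 + length (adj ! v)"
        using that P(3) by (simp_all add: s1)
      then have "p - (?sp - 1) < length (adj ! v)" by simp
      then have "adj ! v ! (p - (?sp - 1)) < n"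
        using set_adj[OF vn] nbs_less nth_mem by blast
      then show ?thesis using p P(11) by (simp add: s1)
    qed
    \<comment> \<open>Neighbours of \<open>v\<close> have just been pushed. Other vertices keep
      their remaining degree, and their old stack entry is not the popped one, which was
      \<open>v\<close>.\<close>
    have cover: "\<exists>p<scalars s' 2. arrays s' 5 p = u"
      if u: "u < scalars s 3" "u \<notin> insert v ?R" "card (nbs E u - insert v ?R) \<le> scalars s 4" for u
    proof (cases "u \<in> nbs E v")
      case True
      then obtain x where "x < length (adj ! v)" "adj ! v ! x = u"
        using set_adj[OF vn] by (metis in_set_conv_nth)
      then show ?thesis
        using P(3,11) by (intro exI[of _ "?sp - 1 + x"]) (simp add: s1)
    next
      case False
      then have "nbs E u - insert v ?R = nbs E u - ?R" using nbs_sym[of u E v] by auto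
      then obtain p where p: "p < ?sp" "arrays s 5 p = u" using u inv by (auto simp: peel_inv_def)
      then have "p \<noteq> ?sp - 1" using u v by auto
      then have "p < ?sp - 1" using p by simp
      then show ?thesis using p P(3,11) by (intro exI[of _ p]) (simp add: s1)
    qed
    have "peel_inv s'"
      unfolding peel_inv_def R' D'
      using inv P(1-7) ch dec' stack cover low removed_less[of s] by (auto simp: peel_inv_def s1)
    moreover have "pot s' + t + 50 \<le> pot s"
    proof -
      have "(\<Sum>u\<in>{..<n} - ?R. 2 * card (nbs E u) + 1)
          = 2 * ?c + 1 + (\<Sum>u\<in>{..<n} - ?R - {v}. 2 * card (nbs E u) + 1)"
        using vn low by (intro sum.remove) auto
      moreover have "{..<n} - ?R - {v} = {..<n} - insert v ?R" by auto
      ultimately show ?thesis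
        using t sp P(3-5) unfolding pot_def R' len by (simp add: s1 len)
    qed
    ultimately show ?thesis by simp
  qed
  show ?thesis
    by (rule wp_mono[OF wp_remove_vertex[OF \<open>scalars s1 5 = v\<close> vn arr]]) (elim conjE, rule goal)
qed

text \<open>With an empty stack and the cursor at the end, all remaining degrees exceed the
  threshold, but degeneracy yields one that is at most \<open>d\<close>.\<close>

lemma peel_inv_threshold:
  assumes inv: "peel_inv s" and "scalars s 1 < n" "scalars s 2 = 0" "scalars s 3 = n"
  shows "scalars s 4 < d"
proof -
  let ?W = "{..<n} - removed s"
  have "?W \<noteq> {}"
  proof
    assume "?W = {}"
    then have "removed s = {..<n}" using removed_less[of s] by auto
    then show False using assms by (simp add: peel_inv_def)
  qed
  then obtain v where v: "v \<in> ?W" "card (nbs E v \<inter> ?W) \<le> d"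
    using degenerate_low_degree_vertex[OF graph degen, of ?W] by auto
  have "nbs E v \<inter> ?W = nbs E v - removed s" using nbs_less by auto
  moreover have "\<not> card (nbs E v - removed s) \<le> scalars s 4"
    using inv v assms by (auto simp: peel_inv_def)
  ultimately show ?thesis using v by simp
qed

lemma peel_inv_size: "peel_inv s \<Longrightarrow> scalars s 0 = n" "peel_inv s \<Longrightarrow> scalars s 1 = card (removed s)"
  by (simp_all add: peel_inv_def)

lemma peel_inv_step:
  assumes inv: "peel_inv s" and run: "scalars s 1 < n"
  shows "wp peel_body s (\<lambda>t s'. peel_inv s' \<and> pot s' + t + bcost (Less (Var 1) (Var 0)) < pot s)"
proof -
  let ?R = "removed s" and ?sp = "scalars s 2"
  consider "?sp > 0" | "?sp = 0" "scalars s 3 < n" | "?sp = 0" "scalars s 3 = n"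
    using inv by (fastforce simp: peel_inv_def)
  then show ?thesis
  proof cases
    case 1
    define v where "v = arrays s 5 (?sp - 1)"
    define s1 where "s1 = s\<lparr>scalars := (scalars s)(2 := ?sp - 1, 5 := v)\<rparr>"
    have vn: "v < n" using inv 1 by (simp add: peel_inv_def v_def)
    have s1_simps: "removed s1 = ?R" "output_set n s1 = output_set n s" "arrays s1 = arrays s"
      by (simp_all add: s1_def removed_def output_set_def)
    let ?test = "arrays s 3 v = 0 \<and> off (Suc v) < off v + arrays s 4 v + Suc (scalars s 4)"
    have test: "?test \<longleftrightarrow> v \<notin> ?R \<and> card (nbs E v - ?R) \<le> scalars s 4"
      using inv vn card_nbs_split[of v ?R]
      by (auto simp: peel_inv_def removed_def off_Suc length_adj)
    \<comment> \<open>31 is the cost of the branch test, the pop and the filter; \<open>Skip\<close>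
      adds one.\<close>
    have body: "wp peel_body s Q \<longleftrightarrow>
        (if ?test then wp remove_vertex s1 (\<lambda>t. Q (31 + t)) else Q 32 s1)" for Q
    proof -
      have s1': "s\<lparr>scalars := (scalars s)(2 := ?sp - Suc 0, 5 := v)\<rparr> = s1"
        by (simp add: s1_def)
      have "arrays s 0 = off" "arrays s 5 (?sp - Suc 0) = v"
        using inv by (simp_all add: peel_inv_def v_def)
      then show ?thesis
        using 1 by (simp add: peel_body_def wp_simps s1') (simp add: eval_nat_numeral)
    qed
    show ?thesis
    proof (cases ?test)
      case True
      then show ?thesis
        using peel_inv_remove_vertex[OF inv 1 v_def _ _ s1_def] test unfolding body
        by (auto elim!: wp_mono)
    next
      case False
      \<comment> \<open>A discarded vertex is removed or above the threshold, so the invariant does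
        not ask for it.\<close>
      have "\<exists>p<?sp - 1. arrays s 5 p = u"
        if u: "u < scalars s 3" "u \<notin> ?R" "card (nbs E u - ?R) \<le> scalars s 4" for u
      proof -
        obtain p where p: "p < ?sp" "arrays s 5 p = u" using u inv by (auto simp: peel_inv_def)
        then have "p \<noteq> ?sp - 1" using u False test v_def by auto
        then show ?thesis using p by (intro exI[of _ p]) auto
      qed
      then have "peel_inv s1" using inv by (simp add: peel_inv_def s1_simps) (simp add: s1_def)
      moreover have "pot s1 + 200 = pot s" using 1 by (simp add: pot_def s1_simps) (simp add: s1_def)
      ultimately show ?thesis unfolding body using False by auto
    qed
  next
    case 2
    define s1 where "s1 = s\<lparr>arrays := (arrays s)(5 := (arrays s 5)(0 := scalars s 3)),
      scalars := (scalars s)(2 := Suc 0, 3 := Suc (scalars s 3))\<rparr>"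
    have s1_simps: "removed s1 = ?R" "output_set n s1 = output_set n s"
      by (simp_all add: s1_def removed_def output_set_def)
    have "peel_inv s1"
      using inv 2 by (auto simp: peel_inv_def s1_simps) (auto simp: s1_def less_Suc_eq)
    \<comment> \<open>The stack grows by one unit and the cursor term drops by two.\<close>
    moreover have "pot s1 + 200 = pot s"
      using 2 by (simp add: pot_def s1_simps) (simp add: s1_def)
    moreover have "wp peel_body s Q \<longleftrightarrow> Q 19 s1" for Q
      using inv 2 by (simp add: peel_body_def wp_simps peel_inv_def s1_def) (simp add: eval_nat_numeral)
    ultimately show ?thesis by simp
  next
    case 3
    define s1 where "s1 = s\<lparr>scalars := (scalars s)(4 := Suc (scalars s 4), 3 := 0)\<rparr>"
    have s1_simps: "removed s1 = ?R" "output_set n s1 = output_set n s"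
      by (simp_all add: s1_def removed_def output_set_def)
    have k: "scalars s 4 < d" using peel_inv_threshold[OF inv run 3] .
    have "peel_inv s1"
      using inv 3 k by (simp add: peel_inv_def s1_simps) (simp add: s1_def)
    \<comment> \<open>The threshold term drops by \<open>2 * n + 1\<close>, and restarting the
      cursor takes \<open>2 * n\<close> of it.\<close>
    moreover have "pot s1 + 200 = pot s"
    proof -
      have "d - scalars s 4 = Suc (d - Suc (scalars s 4))" using k by simp
      then show ?thesis using 3 by (simp add: pot_def s1_simps) (simp add: s1_def)
    qed
    moreover have "wp peel_body s Q \<longleftrightarrow> Q 14 s1" for Q
      using inv 3 by (simp add: peel_body_def wp_simps peel_inv_def s1_def) (simp add: eval_nat_numeral)
    ultimately show ?thesis by simp
  qed
qed

section \<open>Initial state and total running time\<close>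

lemma peel_inv_input_state: "peel_inv (input_state n adj)"
proof -
  have "removed (input_state n adj) = {}" "output_set n (input_state n adj) = {}"
    by (auto simp: removed_def output_set_def input_state_def)
  moreover have "\<exists>U. charging {..<n} E d {} {} U" using charging_empty by blast
  ultimately show ?thesis
    by (simp add: peel_inv_def off_def nbr_def) (simp add: input_state_def)
qed

text \<open>The degree sum is at most \<open>2 * d * n\<close>, the threshold term is
  \<open>2 * d * n + d\<close>, and the linear terms are absorbed using
  \<open>n \<le> d * n\<close>.\<close>

lemma pot_input_state: "pot (input_state n adj) \<le> 2000 * (d * n) + 200 * d"
proof -
  define A where "A = (\<Sum>v<n. 2 * card (nbs E v) + 1)"
  have R: "removed (input_state n adj) = {}" by (simp add: removed_def input_state_def)
  have "(\<Sum>v<n. card (nbs E v \<inter> {..<n})) \<le> 2 * d * card {..<n}"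
    using degenerate_degree_sum[OF graph degen] by blast
  moreover have "nbs E v \<inter> {..<n} = nbs E v" for v using nbs_less by auto
  moreover have "A = 2 * (\<Sum>v<n. card (nbs E v)) + n"
    unfolding A_def by (simp only: sum.distrib sum_distrib_left[symmetric]) simp
  ultimately have "A \<le> 4 * (d * n) + n" by simp
  moreover have "n \<le> d * n" using d_pos by simp
  moreover have "pot (input_state n adj) = 200 * (A + 2 * n + (2 * (d * n) + d))"
    unfolding pot_def R A_def by (simp add: input_state_def)
  moreover have "200 * (A + 2 * n + (2 * m + d)) \<le> 2000 * m + 200 * d"
    if "A \<le> 4 * m + n" "n \<le> m" for m
    using that by simp
  ultimately show ?thesis by metis
qed

lemma peel_correct:
  "\<exists>t s. exec peel (input_state n adj) t s \<and> t \<le> 2000 * (d * n) + 200 * d + 4 \<and>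
     dominating_set {..<n} E (output_set n s) \<and>
     card (output_set n s) \<le> d\<^sup>2 * domination_number {..<n} E"
proof -
  have "wp (While (Less (Var 1) (Var 0)) peel_body) (input_state n adj)
      (\<lambda>t s'. peel_inv s' \<and> \<not> beval s' (Less (Var 1) (Var 0)) \<and>
         t \<le> pot (input_state n adj) + 1 + bcost (Less (Var 1) (Var 0)))"
    by (rule wp_While_potential[where I = peel_inv and pot = pot])
      (use peel_inv_step peel_inv_input_state peel_inv_size in auto)
  then obtain t s where s: "exec peel (input_state n adj) t s" "peel_inv s" "n \<le> card (removed s)"
      "t \<le> pot (input_state n adj) + 4"
    using peel_inv_size by (auto simp: wp_def peel_def)
  have "removed s = {..<n}"
    using s(3) removed_less(1)[of s] by (intro card_seteq) auto
  then obtain U where "charging {..<n} E d {..<n} (output_set n s) U"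
    using s(2) by (auto simp: peel_inv_def)
  then show ?thesis
    using charging_complete[OF graph] s pot_input_state by fastforce
qed

end

theorem theorem12:
  "\<exists>(prog :: com) (C :: real). \<forall>(n :: nat) (d :: nat) (E :: nat set set) (adj :: nat list list).
     simple_graph {..<n} E \<and> d \<ge> 1 \<and> degenerate d {..<n} E \<and> adjacency_lists n E adj \<longrightarrow>
     (\<exists>t s. exec prog (input_state n adj) t s \<and>
        (n \<ge> 2 \<longrightarrow> real t \<le> C * (real d * real n * log 2 (real n))) \<and>
        dominating_set {..<n} E (output_set n s) \<and>
        card (output_set n s) \<le> d\<^sup>2 * domination_number {..<n} E)"
proof (intro exI[of _ peel] exI[of _ "2204 :: real"] allI impI)
  fix n d :: nat and E :: "nat set set" and adj :: "nat list list"
  assume "simple_graph {..<n} E \<and> d \<ge> 1 \<and> degenerate d {..<n} E \<and> adjacency_lists n E adj"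
  then interpret adjacency_input n d E adj by unfold_locales auto
  obtain t s where s: "exec peel (input_state n adj) t s" "t \<le> 2000 * (d * n) + 200 * d + 4"
      "dominating_set {..<n} E (output_set n s)"
      "card (output_set n s) \<le> d\<^sup>2 * domination_number {..<n} E"
    using peel_correct by blast
  have "real t \<le> 2204 * (real d * real n * log 2 (real n))" if n: "n \<ge> 2"
  proof -
    have "d \<le> d * n" "1 \<le> d * n" using d_pos n by simp_all
    \<comment> \<open>2204 is \<open>2000 + 200 + 4\<close>. The logarithm, at least 1 for
      \<open>n \<ge> 2\<close>, only weakens this linear bound.\<close>
    then have "t \<le> 2204 * (d * n)" using s(2) by linarith
    then have "real t \<le> 2204 * (real d * real n) * 1"
      by (metis (mono_tags) mult.right_neutral of_nat_le_iff of_nat_mult of_nat_numeral)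
    also have "\<dots> \<le> 2204 * (real d * real n) * log 2 (real n)"
      using n by (intro mult_left_mono) auto
    finally show ?thesis by simp
  qed
  with s show "\<exists>t s. exec peel (input_state n adj) t s \<and>
        (n \<ge> 2 \<longrightarrow> real t \<le> 2204 * (real d * real n * log 2 (real n))) \<and>
        dominating_set {..<n} E (output_set n s) \<and>
        card (output_set n s) \<le> d\<^sup>2 * domination_number {..<n} E"
    by blast
qed

end
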